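(* Let $d\ge 1$ be an integer, let $\bm{y}=(y_1,\dots,y_d)^{\mathrm T}\sim\mathcal{N}(\bar{\bm{y}},\bm{\Sigma}_y)$ be an $\mathbb{R}^d$-valued Gaussian random vector with mean $\bar{\bm{y}}$ and covariance matrix $\bm{\Sigma}_y$, and let $\beta\in(0,1)$. If $$\bar y_i+\Psi_d^{-1}(\beta)\,\rho(\bm{\Sigma}_y)\le 0\quad\text{for all } i\in\{1,\dots,d\},$$ then $$\mathbb{P}(\bm{y}\preceq\bm{0})\ge 1-\beta .$$
   Context: For $\bm{a},\bm{b}\in\mathbb{R}^d$, $\bm{a}\preceq\bm{b}$ means $a_i\le b_i$ for all $i\in\{1,\dots,d\}$. $\rho(\bm{M})$ denotes the positive square root of the spectral radius of the matrix $\bm{M}$ (so it is the square root of the spectral radius, not the spectral radius itself). $\Phi_d$ denotes the cumulative distribution function of the chi-squared distribution with $d$ degrees of freedom, $\Phi_d^{-1}$ its inverse, and $\Psi_d^{-1}(\beta)=\sqrt{\Phi_d^{-1}(1-\beta)}$. *)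

theory Defs
  imports "HOL-Probability.Probability"
begin

definition eigenvalues :: "real ^ 'n ^ 'n \<Rightarrow> complex set" where
  "eigenvalues A =
     {c. \<exists>v :: complex ^ 'n. v \<noteq> 0 \<and> map_matrix complex_of_real A *v v = c *s v}"

definition spectral_radius :: "real ^ 'n ^ 'n \<Rightarrow> real" where
  "spectral_radius A = (SUP c \<in> eigenvalues A. cmod c)"

definition rho :: "real ^ 'n ^ 'n \<Rightarrow> real" where
  "rho A = sqrt (spectral_radius A)"

definition chi_squared :: "nat \<Rightarrow> real measure" where
  "chi_squared d =
     distr (Pi\<^sub>M {..<d} (\<lambda>_. std_normal_distribution)) borel (\<lambda>z. \<Sum>i<d. (z i)\<^sup>2)"

definition Phi :: "nat \<Rightarrow> real \<Rightarrow> real" where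
  "Phi d = cdf (chi_squared d)"

text \<open>
  \<open>Phi d\<close> vanishes on the negative reals, so it is inverted on \<open>{0..}\<close>, where it is
  strictly increasing for \<open>d \<ge> 1\<close>.
\<close>

definition Phi_inv :: "nat \<Rightarrow> real \<Rightarrow> real" where
  "Phi_inv d = inv_into {0..} (Phi d)"

definition Psi_inv :: "nat \<Rightarrow> real \<Rightarrow> real" where
  "Psi_inv d \<beta> = sqrt (Phi_inv d (1 - \<beta>))"

text \<open>The second parameter is the standard deviation; the value 0 gives a point mass.\<close>

definition normal_law :: "real \<Rightarrow> real \<Rightarrow> real measure" where
  "normal_law \<mu> \<sigma> =
     (if \<sigma> = 0 then return borel \<mu> else density lborel (normal_density \<mu> \<sigma>))"

definition covariance_matrix :: "'a measure \<Rightarrow> ('a \<Rightarrow> real ^ 'n) \<Rightarrow> real ^ 'n ^ 'n" where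
  "covariance_matrix M y =
     (\<chi> i j. \<integral>\<omega>. (y \<omega> $ i - (\<integral>\<omega>. y \<omega> $ i \<partial>M)) * (y \<omega> $ j - (\<integral>\<omega>. y \<omega> $ j \<partial>M)) \<partial>M)"

text \<open>
  A random vector is Gaussian if all its linear combinations are normal, possibly degenerate;
  the covariance matrix may thus be singular. This makes all components square-integrable,
  so the mean and the covariance matrix are genuine integrals.
\<close>

definition gaussian_vector :: "'a measure \<Rightarrow> ('a \<Rightarrow> real ^ 'n) \<Rightarrow> bool" where
  "gaussian_vector M y \<longleftrightarrow>
     y \<in> borel_measurable M \<and>
     (\<forall>a. \<exists>\<mu> \<sigma>. 0 \<le> \<sigma> \<and> distr M borel (\<lambda>\<omega>. a \<bullet> y \<omega>) = normal_law \<mu> \<sigma>)"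

definition multivariate_normal ::
    "'a measure \<Rightarrow> ('a \<Rightarrow> real ^ 'n) \<Rightarrow> real ^ 'n \<Rightarrow> real ^ 'n ^ 'n \<Rightarrow> bool" where
  "multivariate_normal M y m S \<longleftrightarrow>
     gaussian_vector M y \<and> (\<integral>\<omega>. y \<omega> \<partial>M) = m \<and> covariance_matrix M y = S"

end

theory Submission
  imports Defs
begin

text \<open>
  Factor the covariance matrix as \<open>S = A A\<^sup>T\<close>. By uniqueness of multivariate characteristic
  functions, \<open>y\<close> has the law of \<open>m + A z\<close> with \<open>z\<close> standard normal. The \<open>i\<close>-th row of \<open>A\<close> has
  squared length \<open>S\<^sub>i\<^sub>i\<close>, which is at most the spectral radius of \<open>S\<close>; so by Cauchy-Schwarz
  every component of \<open>A z\<close> is at most \<open>\<Psi>\<^sup>-\<^sup>1(\<beta>) \<rho>(S)\<close> on the event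
  \<open>|z|\<^sup>2 \<le> \<Phi>\<^sup>-\<^sup>1(1 - \<beta>)\<close>, whose probability is \<open>1 - \<beta>\<close>.
\<close>

subsection \<open>Positive semidefinite matrices\<close>

text \<open>Induction on the support \<open>J\<close>: each step splits off a pivot and passes to the Schur complement.\<close>

lemma psd_rank_one_decomposition:
  fixes S :: "real ^ 'n ^ 'n"
  assumes "finite J"
    and "\<And>i j. S $ i $ j = S $ j $ i"
    and "\<And>x. 0 \<le> x \<bullet> (S *v x)"
    and "\<And>i j. i \<notin> J \<Longrightarrow> S $ i $ j = 0"
  shows "\<exists>A :: 'n \<Rightarrow> real ^ 'n. \<forall>i j. S $ i $ j = (\<Sum>k\<in>J. A k $ i * A k $ j)"
  using assms
proof (induction J arbitrary: S rule: finite_induct)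
  case empty
  then show ?case by simp
next
  case (insert k J)
  note sym = insert.prems(1) and psd = insert.prems(2) and supp = insert.prems(3)
  have row: "x \<bullet> (S *v axis l 1) = (S *v x) $ l" for x l
    by (subst matrix_vector_mult_basis)
      (simp add: column_def inner_vec_def matrix_vector_mult_def sym[of l] mult.commute)
  have entry: "(S *v axis i 1) $ j = S $ j $ i" for i j
    by (simp add: matrix_vector_mult_basis column_def)
  \<comment> \<open>The quadratic form on the plane spanned by two unit vectors; positivity there
    suffices to control the pivot column.\<close>
  have form: "(s *\<^sub>R axis i 1 + t *\<^sub>R axis k 1) \<bullet> (S *v (s *\<^sub>R axis i 1 + t *\<^sub>R axis k 1))
      = s\<^sup>2 * S $ i $ i + 2 * s * t * S $ i $ k + t\<^sup>2 * S $ k $ k" for i s t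
    by (simp add: matrix_vector_right_distrib matrix_vector_mult_scaleR inner_add_left inner_add_right row entry
        sym[of k i] power2_eq_square algebra_simps)
  have diag: "0 \<le> S $ k $ k"
    using psd[of "axis k 1"] by (simp add: row entry)
  \<comment> \<open>A zero pivot forces its whole column to vanish: otherwise the form would be a
    nonconstant affine function of \<open>t\<close>, hence negative somewhere.\<close>
  have zero: "S $ i $ k = 0" if "S $ k $ k = 0" for i
  proof (rule ccontr)
    assume ne: "S $ i $ k \<noteq> 0"
    have "0 \<le> S $ i $ i + 2 * t * S $ i $ k" for t
      using psd[of "1 *\<^sub>R axis i 1 + t *\<^sub>R axis k 1"] that unfolding form by simp
    \<comment> \<open>At this \<open>t\<close> the right-hand side equals -1.\<close>
    from this[of "- (S $ i $ i + 1) / (2 * S $ i $ k)"] show False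
      using ne by (simp add: field_simps)
  qed
  \<comment> \<open>The pivot column, scaled so that subtracting its outer square clears row and
    column \<open>k\<close>. For a zero pivot, division by zero makes \<open>a\<close> the zero
    vector, and \<open>S'\<close> is just \<open>S\<close>.\<close>
  define a where "a = (\<chi> i. S $ i $ k / sqrt (S $ k $ k))"
  define S' where "S' = (\<chi> i j. S $ i $ j - a $ i * a $ j)"
  have aa: "a $ i * a $ j = S $ i $ k * S $ j $ k / S $ k $ k" for i j
    using diag by (simp add: a_def)
  have S'x: "x \<bullet> (S' *v x) = x \<bullet> (S *v x) - ((S *v x) $ k)\<^sup>2 / S $ k $ k" for x
  proof -
    have "S' *v x = S *v x - (a \<bullet> x) *\<^sub>R a"
      by (simp add: vec_eq_iff S'_def matrix_vector_mult_def inner_vec_def sum_subtractf sum_distrib_left algebra_simps)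
    moreover have "a \<bullet> x = (S *v x) $ k / sqrt (S $ k $ k)"
      unfolding row[symmetric]
      by (simp add: a_def matrix_vector_mult_basis column_def inner_vec_def sum_divide_distrib mult.commute)
    ultimately show ?thesis
      using diag by (simp add: inner_diff_right inner_commute[of x a] power_divide flip: power2_eq_square)
  qed
  have "\<exists>A. \<forall>i j. S' $ i $ j = (\<Sum>k\<in>J. A k $ i * A k $ j)"
  proof (rule insert.IH)
    show "S' $ i $ j = S' $ j $ i" for i j
      by (simp add: S'_def sym[of i j])
    show "0 \<le> x \<bullet> (S' *v x)" for x
    proof (cases "S $ k $ k = 0")
      case True
      then show ?thesis using psd[of x] by (simp add: S'x)
    next
      case False
      \<comment> \<open>The minimiser of the form along \<open>x - t *\<^sub>R axis k 1\<close>.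
        Completing the square shows that the minimum is the Schur complement's form at
        \<open>x\<close>, so positivity is inherited.\<close>
      define t where "t = (S *v x) $ k / S $ k $ k"
      have "0 \<le> (x - t *\<^sub>R axis k 1) \<bullet> (S *v (x - t *\<^sub>R axis k 1))"
        by (rule psd)
      also have "\<dots> = x \<bullet> (S *v x) - 2 * t * (S *v x) $ k + t\<^sup>2 * S $ k $ k"
        by (simp add: matrix_vector_mult_diff_distrib matrix_vector_mult_scaleR inner_diff_left inner_diff_right row entry
            inner_axis' power2_eq_square algebra_simps)
      also have "\<dots> = x \<bullet> (S' *v x)"
        using False by (simp add: S'x t_def field_simps power2_eq_square)
      finally show ?thesis .
    qed
    show "S' $ i $ j = 0" if "i \<notin> J" for i j
    proof (cases "i = k")
      case True
      then show ?thesis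
        using zero[of j] by (cases "S $ k $ k = 0") (simp_all add: S'_def aa sym[of k j])
    next
      case False
      with that have "S $ i $ l = 0" for l
        by (intro supp) simp
      then show ?thesis by (simp add: S'_def aa)
    qed
  qed
  then obtain A where A: "\<And>i j. S' $ i $ j = (\<Sum>k\<in>J. A k $ i * A k $ j)"
    by blast
  have "S $ i $ j = (\<Sum>l\<in>insert k J. (A(k := a)) l $ i * (A(k := a)) l $ j)" for i j
  proof -
    have "(\<Sum>l\<in>J. (A(k := a)) l $ i * (A(k := a)) l $ j) = (\<Sum>l\<in>J. A l $ i * A l $ j)"
      using insert.hyps by (intro sum.cong) auto
    then show ?thesis
      using insert.hyps A[of i j] by (simp add: S'_def)
  qed
  then show ?case by blast
qed

section \<open>Eigenvalues, spectral radius and quadratic forms\<close>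

lemma bdd_above_cmod_eigenvalues: "bdd_above (cmod ` eigenvalues A)"
proof (rule bdd_aboveI2)
  fix c assume "c \<in> eigenvalues A"
  then obtain v where v: "v \<noteq> 0" "map_matrix complex_of_real A *v v = c *s v"
    unfolding eigenvalues_def by blast
  \<comment> \<open>In the row where the eigenvector has its largest component, the eigenvalue
    equation bounds \<open>cmod c\<close> by the absolute row sum. Adding all rows makes the bound
    independent of the eigenvector.\<close>
  have "Max (range (\<lambda>j. cmod (v $ j))) \<in> range (\<lambda>j. cmod (v $ j))"
    by (rule Max_in) auto
  then obtain i where "Max (range (\<lambda>j. cmod (v $ j))) = cmod (v $ i)" by blast
  then have i: "cmod (v $ j) \<le> cmod (v $ i)" for j
    by (metis Max_ge finite finite_imageI rangeI)
  have "v $ i \<noteq> 0"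
  proof
    assume "v $ i = 0"
    then have "v $ j = 0" for j using i[of j] by simp
    then show False using v(1) by (simp add: vec_eq_iff)
  qed
  have "cmod c * cmod (v $ i) = cmod (\<Sum>j\<in>UNIV. A $ i $ j * v $ j)"
    using arg_cong[OF v(2), of "\<lambda>w. cmod (w $ i)"]
    by (simp add: matrix_vector_mult_def map_matrix_def norm_mult)
  also have "\<dots> \<le> (\<Sum>j\<in>UNIV. \<bar>A $ i $ j\<bar> * cmod (v $ i))"
    by (intro sum_norm_le) (auto simp: norm_mult intro!: mult_left_mono i)
  also have "\<dots> = (\<Sum>j\<in>UNIV. \<bar>A $ i $ j\<bar>) * cmod (v $ i)"
    by (simp add: sum_distrib_right)
  finally have "cmod c \<le> (\<Sum>j\<in>UNIV. \<bar>A $ i $ j\<bar>)"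
    using \<open>v $ i \<noteq> 0\<close> by simp
  also have "\<dots> \<le> (\<Sum>i\<in>UNIV. \<Sum>j\<in>UNIV. \<bar>A $ i $ j\<bar>)"
    by (rule member_le_sum) (auto intro: sum_nonneg)
  finally show "cmod c \<le> (\<Sum>i\<in>UNIV. \<Sum>j\<in>UNIV. \<bar>A $ i $ j\<bar>)" .
qed

text \<open>Embedded entrywise in the complex numbers, \<open>v\<close> witnesses \<open>c\<close>
  as a member of \<open>eigenvalues A\<close>. The supremum dominates its modulus because the set of
  moduli is bounded.\<close>

lemma real_eigenvalue_le_spectral_radius:
  assumes "v \<noteq> 0" and "A *v v = c *\<^sub>R v"
  shows "c \<le> spectral_radius A"
proof -
  have "complex_of_real c \<in> eigenvalues A"
    unfolding eigenvalues_def
  proof (intro CollectI exI conjI)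
    let ?w = "\<chi> i. complex_of_real (v $ i)"
    show "?w \<noteq> 0"
      using assms(1) by (auto simp: vec_eq_iff)
    have "(A *v v) $ i = c * v $ i" for i
      by (simp add: assms(2))
    then show "map_matrix complex_of_real A *v ?w = complex_of_real c *s ?w"
      by (simp add: vec_eq_iff matrix_vector_mult_def map_matrix_def flip: of_real_mult of_real_sum)
  qed
  then have "cmod (complex_of_real c) \<le> spectral_radius A"
    unfolding spectral_radius_def by (rule cSUP_upper) (rule bdd_above_cmod_eigenvalues)
  then show ?thesis by simp
qed

text \<open>The form attains its maximum \<open>l\<close> on the compact unit sphere, and a
  maximiser is an eigenvector with eigenvalue \<open>l\<close>. Homogeneity extends the bound to all
  vectors.\<close>

lemma quadratic_form_le_spectral_radius:
  fixes S :: "real ^ 'n ^ 'n"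
  assumes sym: "\<And>i j. S $ i $ j = S $ j $ i"
  shows "x \<bullet> (S *v x) \<le> spectral_radius S * (norm x)\<^sup>2"
proof -
  have sa: "u \<bullet> (S *v w) = w \<bullet> (S *v u)" for u w
  proof -
    have "transpose S = S" by (simp add: transpose_def vec_eq_iff sym)
    then show ?thesis by (metis dot_lmul_matrix inner_commute transpose_matrix_vector)
  qed
  obtain v where v: "v \<in> sphere 0 1" and max: "\<And>x. x \<in> sphere 0 1 \<Longrightarrow> x \<bullet> (S *v x) \<le> v \<bullet> (S *v v)"
  proof -
    have "continuous_on (sphere 0 1) (\<lambda>x. x \<bullet> (S *v x))"
      by (intro continuous_intros linear_continuous_on matrix_vector_mul_bounded_linear)
    moreover have "(axis i 1 :: real ^ 'n) \<in> sphere 0 1" for i :: 'n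
      by (simp add: norm_axis_1)
    ultimately show ?thesis
      using continuous_attains_sup[of "sphere 0 1" "\<lambda>x. x \<bullet> (S *v x)"] that compact_sphere
      by blast
  qed
  define l where "l = v \<bullet> (S *v v)"
  \<comment> \<open>The bilinear form of \<open>l\<close> times the identity minus \<open>S\<close>.
    It is positive semidefinite and vanishes on the diagonal at the maximiser \<open>v\<close>; such
    a null vector must lie in its kernel, which is the eigenvalue equation.\<close>
  define g where "g u w = l * (u \<bullet> w) - u \<bullet> (S *v w)" for u w
  have upper: "x \<bullet> (S *v x) \<le> l * (norm x)\<^sup>2" for x
  proof (cases "x = 0")
    case False
    have "(x /\<^sub>R norm x) \<bullet> (S *v (x /\<^sub>R norm x)) \<le> l"
      unfolding l_def by (rule max) (use False in simp)
    then show ?thesis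
      using False by (simp add: matrix_vector_mult_scaleR field_simps power2_eq_square)
  qed simp
  have g_nonneg: "0 \<le> g u u" for u
    using upper[of u] by (simp add: g_def power2_norm_eq_inner)
  have "v \<bullet> v = 1"
    using v by (simp add: norm_eq_1)
  define u where "u = l *\<^sub>R v - S *v v"
  have u: "g u v = u \<bullet> u"
    unfolding g_def by (simp add: u_def inner_diff_right)
  \<comment> \<open>First-order optimality: moving from \<open>v\<close> a distance of order
    \<open>s\<close> against the residual \<open>u\<close> changes the form by
    \<open>- 2 * s * (u \<bullet> u)\<close> to first order, yet the form stays nonnegative.\<close>
  have "2 * (u \<bullet> u) \<le> s * g u u" if "0 < s" for s
  proof -
    have "0 \<le> g (v - s *\<^sub>R u) (v - s *\<^sub>R u)" by (rule g_nonneg)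
    also have "\<dots> = g v v - 2 * s * g u v + s\<^sup>2 * g u u"
      unfolding g_def using sa[of v u]
      by (simp add: matrix_vector_mult_diff_distrib matrix_vector_mult_scaleR inner_diff_left inner_diff_right
          inner_commute[of v u] power2_eq_square algebra_simps)
    also have "g v v = 0"
      by (simp add: g_def l_def \<open>v \<bullet> v = 1\<close>)
    finally have "0 \<le> s * (s * g u u - 2 * (u \<bullet> u))"
      by (simp add: u power2_eq_square algebra_simps)
    then show ?thesis
      using that by (simp add: zero_le_mult_iff)
  qed
  note perturb = this
  have "u = 0"
  proof (rule ccontr)
    assume "u \<noteq> 0"
    then have pos: "0 < u \<bullet> u" by simp
    \<comment> \<open>Small enough that \<open>s * g u u < u \<bullet> u\<close>; the added 1 keeps
      the denominator positive.\<close>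
    define s where "s = (u \<bullet> u) / (g u u + 1)"
    have "0 < s" and "s * (g u u + 1) = u \<bullet> u"
      using pos g_nonneg[of u] by (simp_all add: s_def add_nonneg_pos)
    with perturb[OF \<open>0 < s\<close>] pos show False
      unfolding distrib_left by linarith
  qed
  then have "S *v v = l *\<^sub>R v"
    by (simp add: u_def)
  moreover have "v \<noteq> 0" using v by auto
  ultimately have "l \<le> spectral_radius S"
    by (intro real_eigenvalue_le_spectral_radius)
  then show ?thesis
    using upper[of x] by (meson mult_right_mono order_trans zero_le_power2)
qed

lemma diagonal_le_spectral_radius:
  fixes S :: "real ^ 'n ^ 'n"
  assumes "\<And>i j. S $ i $ j = S $ j $ i"
  shows "S $ i $ i \<le> spectral_radius S"
  using quadratic_form_le_spectral_radius[OF assms, of "axis i 1"]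
  by (simp add: inner_axis' matrix_vector_mult_basis column_def norm_axis_1)

subsection \<open>Uniqueness of multivariate characteristic functions\<close>

text \<open>Open boxes generate the Borel sets and are stable under intersection, and the cubes
  around the origin exhaust the space with finite measure, so agreement on boxes extends to all
  Borel sets.\<close>

lemma prob_eqI_box:
  fixes P Q :: "'a::euclidean_space measure"
  assumes "prob_space P" "prob_space Q" and sets [simp]: "sets P = sets borel" "sets Q = sets borel"
    and eq: "\<And>a b. emeasure P (box a b) = emeasure Q (box a b)"
  shows "P = Q"
proof (rule measure_eqI_generator_eq)
  interpret P: prob_space P by fact
  let ?E = "range (\<lambda>(a, b). box a b :: 'a set)"
  show "Int_stable ?E"
    by (auto simp: Int_stable_def box_Int_box)
  show "?E \<subseteq> Pow UNIV" "sets P = sigma_sets UNIV ?E" "sets Q = sigma_sets UNIV ?E"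
    by (simp_all add: borel_eq_box)
  let ?A = "\<lambda>n::nat. box (- (real n *\<^sub>R One)) (real n *\<^sub>R One) :: 'a set"
  show "range ?A \<subseteq> ?E" "(\<Union>i. ?A i) = UNIV"
    unfolding UN_box_eq_UNIV by auto
  show "emeasure P (?A i) \<noteq> \<infinity>" for i by simp
  show "emeasure P X = emeasure Q X" if "X \<in> ?E" for X
    using that eq by auto
qed

text \<open>Normalising the densities reduces this to Levy's uniqueness theorem.\<close>

lemma integral_indicator_eqI_char:
  fixes M N :: "'a measure" and X f :: "'a \<Rightarrow> real"
  assumes "finite_measure M" "finite_measure N" and sets: "sets N = sets M"
    and X: "X \<in> borel_measurable M" and f_meas: "f \<in> borel_measurable M"
    and f: "\<And>x. 0 \<le> f x" "\<And>x. f x \<le> C"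
    and eq: "\<And>s. (\<integral>x. f x *\<^sub>R iexp (s * X x) \<partial>M) = (\<integral>x. f x *\<^sub>R iexp (s * X x) \<partial>N)"
    and B: "B \<in> sets borel"
  shows "(\<integral>x. f x * indicator B (X x) \<partial>M) = (\<integral>x. f x * indicator B (X x) \<partial>N)"
proof -
  have int: "integrable M' f" if "finite_measure M'" "sets M' = sets M" for M'
  proof -
    have [measurable]: "f \<in> borel_measurable M'"
      using f_meas measurable_cong_sets[OF that(2) refl] by blast
    show ?thesis
      by (rule finite_measure.integrable_const_bound[OF that(1), of _ C]) (use f in auto)
  qed
  define c where "c = (\<integral>x. f x \<partial>M)"
  \<comment> \<open>The character at frequency 0 is constantly 1, so both measures give
    \<open>f\<close> the same total mass.\<close>
  have c_N: "c = (\<integral>x. f x \<partial>N)"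
    using eq[of 0] by (simp add: scaleR_conv_of_real c_def)
  show ?thesis
  proof (cases "c = 0")
    \<comment> \<open>With total mass zero there is nothing to normalise: the nonnegative
      \<open>f\<close> vanishes almost everywhere under both measures.\<close>
    case True
    have "(\<integral>x. f x * indicator B (X x) \<partial>M') = 0"
      if "finite_measure M'" "sets M' = sets M" "c = (\<integral>x. f x \<partial>M')" for M'
    proof (rule integral_eq_zero_AE)
      have "AE x in M'. f x = 0"
        using integral_nonneg_eq_0_iff_AE[OF int[OF that(1,2)]] f True that(3) by simp
      then show "AE x in M'. f x * indicator B (X x) = 0" by auto
    qed
    with assms(1,2) sets c_def c_N show ?thesis by simp
  next
    case False
    then have c: "0 < c"
      using f Bochner_Integration.integral_nonneg[of M f] by (simp add: c_def less_le)
    \<comment> \<open>Stated for a generic \<open>M'\<close> so that it serves both measures: the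
      law of \<open>X\<close> under the density \<open>f / c\<close> is a probability law whose
      characteristic function and values are the given integrals divided by
      \<open>c\<close>.\<close>
    have normalized: "real_distribution (distr (density M' (\<lambda>x. f x / c)) borel X)
        \<and> (\<forall>s. char (distr (density M' (\<lambda>x. f x / c)) borel X) s
              = (\<integral>x. f x *\<^sub>R iexp (s * X x) \<partial>M') /\<^sub>R c)
        \<and> measure (distr (density M' (\<lambda>x. f x / c)) borel X) B
              = (\<integral>x. f x * indicator B (X x) \<partial>M') / c"
      if fin: "finite_measure M'" and s: "sets M' = sets M" and c': "c = (\<integral>x. f x \<partial>M')" for M'
    proof (intro conjI allI)
      let ?D = "density M' (\<lambda>x. f x / c)"
      have [measurable]: "X \<in> borel_measurable M'" "f \<in> borel_measurable M'"
        using X f_meas measurable_cong_sets[OF s refl] by blast+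
      have "emeasure ?D (space ?D) = (\<integral>\<^sup>+x. ennreal (f x / c) \<partial>M')"
        by (simp add: emeasure_density cong: nn_integral_cong)
      also have "\<dots> = ennreal (\<integral>x. f x / c \<partial>M')"
        using f c int[OF fin s] by (intro nn_integral_eq_integral) auto
      also have "\<dots> = 1" using c c' by simp
      finally interpret D: prob_space ?D by (rule prob_spaceI)
      show "real_distribution (distr ?D borel X)"
        by (rule D.real_distribution_distr) simp
      show "char (distr ?D borel X) s = (\<integral>x. f x *\<^sub>R iexp (s * X x) \<partial>M') /\<^sub>R c" for s
        using c f
        by (simp add: char_def integral_distr integral_density divide_inverse_commute flip: scaleR_scaleR)
      have "measure (distr ?D borel X) B = (\<integral>x. indicat_real B x \<partial>distr ?D borel X)"
        using B by simp
      also have "\<dots> = (\<integral>x. f x / c * indicator B (X x) \<partial>M')"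
        using c f B by (simp add: integral_distr integral_density del: Bochner_Integration.integral_indicator)
      finally show "measure (distr ?D borel X) B = (\<integral>x. f x * indicator B (X x) \<partial>M') / c"
        by simp
    qed
    note M = normalized[OF assms(1) refl c_def] and N = normalized[OF assms(2) sets c_N]
    have "distr (density M (\<lambda>x. f x / c)) borel X = distr (density N (\<lambda>x. f x / c)) borel X"
      using M N eq by (intro Levy_uniqueness ext) auto
    then show ?thesis using M N c by simp
  qed
qed

text \<open>
  The coordinates are handled one at a time: those in \<open>J\<close> are restricted to Borel sets, the others
  still enter through a character. The real form \<open>cos (a \<bullet> x + \<theta>)\<close> makes \<open>1 + cos\<close> a nonnegative
  density, so that the next coordinate can be treated by the one-dimensional uniqueness theorem.
\<close>

lemma multivariate_char_uniqueness:
  fixes P Q :: "'a::euclidean_space measure"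
  assumes "prob_space P" "prob_space Q" and sets: "sets P = sets borel" "sets Q = sets borel"
    and eq: "\<And>a. (\<integral>x. iexp (a \<bullet> x) \<partial>P) = (\<integral>x. iexp (a \<bullet> x) \<partial>Q)"
  shows "P = Q"
proof (rule prob_eqI_box)
  note [measurable_cong] = sets
  interpret P: prob_space P by fact
  interpret Q: prob_space Q by fact
  note sets [simp]
  \<comment> \<open>The indicator that the coordinates in \<open>J\<close> lie in their prescribed
    sets.\<close>
  define G where "G B J x = (\<Prod>j\<in>J. indicator (B j) (x \<bullet> j) :: real)" for B :: "'a \<Rightarrow> real set" and J x
  have G01: "0 \<le> G B J x" "G B J x \<le> 1" for B J x
    unfolding G_def by (auto intro!: prod_nonneg prod_le_1)
  have int: "integrable R h"
    if "R \<in> {P, Q}" "h \<in> borel_measurable borel" "\<And>x. \<bar>h x\<bar> \<le> 1" for R and h :: "'a \<Rightarrow> real"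
    using that by (auto intro!: P.integrable_const_bound[of _ 1] Q.integrable_const_bound[of _ 1])
  \<comment> \<open>Frequency and phase stay arbitrary because the induction step shifts both. With
    \<open>J = Basis\<close>, frequency 0 and phase 0, this compares the measures of boxes.\<close>
  have key: "(\<integral>x. G B J x * cos (a \<bullet> x + \<theta>) \<partial>P) = (\<integral>x. G B J x * cos (a \<bullet> x + \<theta>) \<partial>Q)"
    if "finite J" "J \<subseteq> Basis" "\<And>j. B j \<in> sets borel" for J B a \<theta>
    using that
  proof (induction J arbitrary: a \<theta> rule: finite_induct)
    case empty
    have "(\<integral>x. cos (a \<bullet> x + \<theta>) \<partial>R) = Re (iexp \<theta> * (\<integral>x. iexp (a \<bullet> x) \<partial>R))"
      if "prob_space R" "sets R = sets borel" for R :: "'a measure"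
    proof -
      note [measurable_cong] = that(2)
      interpret R: prob_space R by fact
      have i: "integrable R (\<lambda>x. iexp (a \<bullet> x))"
        by (rule R.integrable_const_bound[of _ 1]) (auto simp: norm_exp_i_times)
      then have "Re (iexp \<theta> * (\<integral>x. iexp (a \<bullet> x) \<partial>R)) = Re (\<integral>x. iexp \<theta> * iexp (a \<bullet> x) \<partial>R)"
        by simp
      also have "\<dots> = (\<integral>x. Re (iexp \<theta> * iexp (a \<bullet> x)) \<partial>R)"
        using i by (intro integral_Re[symmetric] integrable_mult_right)
      also have "\<dots> = (\<integral>x. cos (a \<bullet> x + \<theta>) \<partial>R)"
        by (simp add: Re_exp Im_exp cos_add mult.commute)
      finally show ?thesis ..
    qed
    then show ?case using assms by (simp add: G_def)
  next
    case (insert k J)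
    then have IH: "(\<integral>x. G B J x * cos (a \<bullet> x + \<theta>) \<partial>P) = (\<integral>x. G B J x * cos (a \<bullet> x + \<theta>) \<partial>Q)" for a \<theta>
      by simp
    note [measurable] = insert.prems(2)
    have [measurable]: "G B J \<in> borel_measurable borel" "G B (insert k J) \<in> borel_measurable borel"
      unfolding G_def by measurable
    have cos_bounds: "0 \<le> 1 + cos u" "1 + cos u \<le> 2" for u :: real
      using cos_ge_minus_one[of u] cos_le_one[of u] by linarith+
    have density_bounds: "0 \<le> G B J x * (1 + cos u)" "G B J x * (1 + cos u) \<le> 2" for x u
    proof -
      show "0 \<le> G B J x * (1 + cos u)"
        by (intro mult_nonneg_nonneg G01 cos_bounds)
      have "G B J x * (1 + cos u) \<le> 1 * 2"
        by (intro mult_mono G01 cos_bounds) simp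
      then show "G B J x * (1 + cos u) \<le> 2" by simp
    qed
    have main: "(\<integral>x. G B J x * (1 + cos (a \<bullet> x + \<theta>)) * indicator (B k) (x \<bullet> k) \<partial>P)
        = (\<integral>x. G B J x * (1 + cos (a \<bullet> x + \<theta>)) * indicator (B k) (x \<bullet> k) \<partial>Q)" for a \<theta>
    proof (rule integral_indicator_eqI_char[where C=2])
      show "finite_measure P" "finite_measure Q" "sets Q = sets P" by unfold_locales simp
      show "B k \<in> sets borel" by fact
      show "0 \<le> G B J x * (1 + cos (a \<bullet> x + \<theta>))" for x
        by (rule density_bounds)
      show "G B J x * (1 + cos (a \<bullet> x + \<theta>)) \<le> 2" for x
        by (rule density_bounds)
      \<comment> \<open>The product of two cosines is half the sum of the cosines of the sum and the
        difference of the arguments, so all three resulting integrals have the shape covered by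
        \<open>IH\<close>.\<close>
      have split: "(\<integral>x. G B J x * (1 + cos (a \<bullet> x + \<theta>)) * cos (s * (x \<bullet> k) + \<phi>) \<partial>R)
          = (\<integral>x. G B J x * cos ((s *\<^sub>R k) \<bullet> x + \<phi>) \<partial>R)
            + ((\<integral>x. G B J x * cos ((a + s *\<^sub>R k) \<bullet> x + (\<theta> + \<phi>)) \<partial>R)
            + (\<integral>x. G B J x * cos ((a - s *\<^sub>R k) \<bullet> x + (\<theta> - \<phi>)) \<partial>R)) / 2"
        if R: "R \<in> {P, Q}"
        for R :: "'a measure" and s \<phi> :: real
      proof -
        have i: "integrable R (\<lambda>x. G B J x * cos (b \<bullet> x + \<psi>))" for b \<psi>
          using G01 by (intro int[OF R]) (auto simp: abs_mult intro!: mult_le_one)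
        have "G B J x * (1 + cos (a \<bullet> x + \<theta>)) * cos (s * (x \<bullet> k) + \<phi>)
          = G B J x * cos ((s *\<^sub>R k) \<bullet> x + \<phi>)
            + (G B J x * cos ((a + s *\<^sub>R k) \<bullet> x + (\<theta> + \<phi>)) + G B J x * cos ((a - s *\<^sub>R k) \<bullet> x + (\<theta> - \<phi>))) / 2" for x
        proof -
          define u w where "u = a \<bullet> x + \<theta>" and "w = s * (x \<bullet> k) + \<phi>"
          have "(a + s *\<^sub>R k) \<bullet> x + (\<theta> + \<phi>) = u + w" "(a - s *\<^sub>R k) \<bullet> x + (\<theta> - \<phi>) = u - w"
            "(s *\<^sub>R k) \<bullet> x + \<phi> = w"
            by (simp_all add: u_def w_def inner_add_left inner_diff_left inner_commute[of x k])
          then show ?thesis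
            by (simp only: flip: u_def w_def) (simp add: cos_add cos_diff field_simps)
        qed
        then show ?thesis
          by (simp add: i i[of "s *\<^sub>R k", simplified])
      qed
      have real_eq: "(\<integral>x. G B J x * (1 + cos (a \<bullet> x + \<theta>)) * cos (s * (x \<bullet> k) + \<phi>) \<partial>P)
          = (\<integral>x. G B J x * (1 + cos (a \<bullet> x + \<theta>)) * cos (s * (x \<bullet> k) + \<phi>) \<partial>Q)" for s \<phi>
        by (simp only: split insertI1 insertI2 IH)
      \<comment> \<open>The sine is a cosine with phase \<open>- (pi / 2)\<close>, so one
        phase-dependent identity handles real and imaginary part; the \<open>+ 0\<close> matches the
        form of \<open>real_eq\<close>.\<close>
      have parts: "(\<integral>x. (G B J x * (1 + cos (a \<bullet> x + \<theta>))) *\<^sub>R iexp (s * (x \<bullet> k)) \<partial>R)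
          = Complex (\<integral>x. G B J x * (1 + cos (a \<bullet> x + \<theta>)) * cos (s * (x \<bullet> k) + 0) \<partial>R)
              (\<integral>x. G B J x * (1 + cos (a \<bullet> x + \<theta>)) * cos (s * (x \<bullet> k) + - (pi / 2)) \<partial>R)" 
          if "prob_space R" "sets R = sets borel" for R :: "'a measure" and s
      proof -
        note [measurable_cong] = that(2)
        interpret R: prob_space R by fact
        have "norm ((G B J x * (1 + cos (a \<bullet> x + \<theta>))) *\<^sub>R iexp (s * (x \<bullet> k))) \<le> 2" for x
          using density_bounds[of x "a \<bullet> x + \<theta>"] by (simp add: norm_exp_i_times flip: abs_mult)
        then have "integrable R (\<lambda>x. (G B J x * (1 + cos (a \<bullet> x + \<theta>))) *\<^sub>R iexp (s * (x \<bullet> k)))"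
          by (intro R.integrable_const_bound[of _ 2]) auto
        then show ?thesis
          by (simp add: complex_eq_iff Re_exp Im_exp cos_diff flip: integral_Re integral_Im)
      qed
      show "(\<integral>x. (G B J x * (1 + cos (a \<bullet> x + \<theta>))) *\<^sub>R iexp (s * (x \<bullet> k)) \<partial>P)
          = (\<integral>x. (G B J x * (1 + cos (a \<bullet> x + \<theta>))) *\<^sub>R iexp (s * (x \<bullet> k)) \<partial>Q)" for s
        using assms by (simp only: parts real_eq)
    qed simp_all
    have G_insert: "G B (insert k J) x = G B J x * indicator (B k) (x \<bullet> k)" for x
      using insert.hyps by (simp add: G_def mult.commute)
    have split: "(\<integral>x. G B J x * (1 + cos (a \<bullet> x + \<theta>)) * indicator (B k) (x \<bullet> k) \<partial>R)
        = (\<integral>x. G B (insert k J) x \<partial>R) + (\<integral>x. G B (insert k J) x * cos (a \<bullet> x + \<theta>) \<partial>R)"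
      if R: "R \<in> {P, Q}"
      for R :: "'a measure" and a \<theta>
    proof -
      have "integrable R (\<lambda>x. G B (insert k J) x * cos (a \<bullet> x + \<theta>))" "integrable R (G B (insert k J))"
        using G01 by (auto intro!: int[OF R] mult_le_one simp: abs_mult G_insert split: split_indicator)
      then have "(\<integral>x. G B (insert k J) x \<partial>R) + (\<integral>x. G B (insert k J) x * cos (a \<bullet> x + \<theta>) \<partial>R)
        = (\<integral>x. G B (insert k J) x + G B (insert k J) x * cos (a \<bullet> x + \<theta>) \<partial>R)"
        by simp
      then show ?thesis by (simp add: G_insert algebra_simps)
    qed
    have sum_eq: "(\<integral>x. G B (insert k J) x \<partial>P) + (\<integral>x. G B (insert k J) x * cos (a \<bullet> x + \<theta>) \<partial>P)
      = (\<integral>x. G B (insert k J) x \<partial>Q) + (\<integral>x. G B (insert k J) x * cos (a \<bullet> x + \<theta>) \<partial>Q)" for a \<theta>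
      using main[of a \<theta>] by (simp only: split insertI1 insertI2)
    \<comment> \<open>At frequency 0 and phase 0 the cosine is 1, so \<open>sum_eq\<close> yields
      twice the integral of \<open>G\<close> alone; this term then cancels in the general
      instance.\<close>
    show ?case
      using sum_eq[of a \<theta>] sum_eq[of 0 0] by simp
  qed
  show "emeasure P (box a b) = emeasure Q (box a b)" for a b
  proof -
    have "G (\<lambda>j. {a \<bullet> j<..<b \<bullet> j}) Basis = indicator (box a b)"
      by (auto simp: G_def box_def fun_eq_iff split: split_indicator)
    then have "measure P (box a b) = measure Q (box a b)"
      using key[of Basis "\<lambda>j. {a \<bullet> j<..<b \<bullet> j}" 0 0] by simp
    then show ?thesis
      by (simp add: P.emeasure_eq_measure Q.emeasure_eq_measure)
  qed
qed fact+

subsection \<open>Gaussian vectors and the chi-squared distribution\<close>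

text \<open>Puts the point mass and the density case into one affine form, so that moments and
  characters need no case distinction later.\<close>

lemma normal_law_eq_distr:
  assumes "0 \<le> \<sigma>"
  shows "normal_law \<mu> \<sigma> = distr std_normal_distribution borel (\<lambda>x. \<mu> + \<sigma> * x)"
proof -
  interpret prob_space std_normal_distribution
    by (rule prob_space_normal_density) simp
  show ?thesis
  proof (cases "\<sigma> = 0")
    case True
    then show ?thesis by (simp add: normal_law_def)
  next
    case False
    have "distributed std_normal_distribution lborel (\<lambda>x. x) std_normal_density"
      by (auto simp: distributed_def distr_id2)
    from normal_density_affine[OF this, of \<sigma> \<mu>] False assms
    have "distr std_normal_distribution lborel (\<lambda>x. \<mu> + \<sigma> * x) = density lborel (normal_density \<mu> \<sigma>)"
      by (simp add: distributed_def)
    moreover have "distr std_normal_distribution lborel (\<lambda>x. \<mu> + \<sigma> * x)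
        = distr std_normal_distribution borel (\<lambda>x. \<mu> + \<sigma> * x)"
      by (rule distr_cong) auto
    ultimately show ?thesis using False by (simp add: normal_law_def)
  qed
qed

lemma char_std_normal_affine:
  "(\<integral>x. iexp (\<mu> + \<sigma> * x) \<partial>std_normal_distribution) = iexp \<mu> * of_real (exp (- \<sigma>\<^sup>2 / 2))"
proof -
  have "(\<integral>x. iexp (\<mu> + \<sigma> * x) \<partial>std_normal_distribution) = (\<integral>x. iexp \<mu> * iexp (\<sigma> * x) \<partial>std_normal_distribution)"
    by (simp add: distrib_left exp_add)
  also have "\<dots> = iexp \<mu> * char std_normal_distribution \<sigma>"
    by (simp add: char_def)
  finally show ?thesis by (simp add: char_std_normal_distribution)
qed

lemma std_normal_moments:
  "integrable std_normal_distribution (\<lambda>x. x)" "(\<integral>x. x \<partial>std_normal_distribution) = 0"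
  "integrable std_normal_distribution (\<lambda>x. x\<^sup>2)" "(\<integral>x. x\<^sup>2 \<partial>std_normal_distribution) = 1"
proof -
  show "integrable std_normal_distribution (\<lambda>x. x)"
    using integrable_std_normal_moment[of 1] by (subst integrable_density) simp_all
  show "(\<integral>x. x \<partial>std_normal_distribution) = 0"
    using integral_std_normal_moment_odd[of 0] by (subst integral_density) simp_all
  show "integrable std_normal_distribution (\<lambda>x. x\<^sup>2)"
    using integrable_std_normal_moment[of 2] by (subst integrable_density) simp_all
  show "(\<integral>x. x\<^sup>2 \<partial>std_normal_distribution) = 1"
    using integral_std_normal_moment_even[of 1] by (subst integral_density) simp_all
qed

text \<open>All five facts are integrals of functions of \<open>X\<close> and therefore reduce to
  the standard normal law through its affine image.\<close>

lemma
  fixes X :: "'a \<Rightarrow> real"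
  assumes [measurable]: "X \<in> borel_measurable M" and "0 \<le> \<sigma>"
    and distr: "distr M borel X = normal_law \<mu> \<sigma>"
  shows normal_law_integrable: "integrable M X"
    and normal_law_mean: "(\<integral>\<omega>. X \<omega> \<partial>M) = \<mu>"
    and normal_law_square_integrable: "integrable M (\<lambda>\<omega>. (X \<omega> - \<mu>)\<^sup>2)"
    and normal_law_variance: "(\<integral>\<omega>. (X \<omega> - \<mu>)\<^sup>2 \<partial>M) = \<sigma>\<^sup>2"
    and normal_law_iexp: "(\<integral>\<omega>. iexp (X \<omega>) \<partial>M) = iexp \<mu> * of_real (exp (- \<sigma>\<^sup>2 / 2))"
proof -
  interpret N: prob_space std_normal_distribution
    by (rule prob_space_normal_density) simp
  have D: "distr M borel X = distr std_normal_distribution borel (\<lambda>x. \<mu> + \<sigma> * x)"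
    using distr normal_law_eq_distr[OF \<open>0 \<le> \<sigma>\<close>] by simp
  have int: "integrable M (\<lambda>\<omega>. f (X \<omega>)) = integrable std_normal_distribution (\<lambda>x. f (\<mu> + \<sigma> * x))"
    if [measurable]: "f \<in> borel_measurable borel" for f :: "real \<Rightarrow> real"
    using arg_cong[OF D, of "\<lambda>D. integrable D f"] by (simp add: integrable_distr_eq)
  \<comment> \<open>Kept general in the value type: the moments are real, the character is
    complex.\<close>
  have eq: "(\<integral>\<omega>. f (X \<omega>) \<partial>M) = (\<integral>x. f (\<mu> + \<sigma> * x) \<partial>std_normal_distribution)"
    if [measurable]: "f \<in> borel_measurable borel" for f :: "real \<Rightarrow> 'b :: {banach, second_countable_topology}"
    using arg_cong[OF D, of "\<lambda>D. integral\<^sup>L D f"] by (simp add: integral_distr)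
  show "integrable M X" "(\<integral>\<omega>. X \<omega> \<partial>M) = \<mu>"
    using int[of "\<lambda>x. x"] eq[of "\<lambda>x :: real. x"]
    by (simp_all add: std_normal_moments N.prob_space[simplified])
  show "integrable M (\<lambda>\<omega>. (X \<omega> - \<mu>)\<^sup>2)" "(\<integral>\<omega>. (X \<omega> - \<mu>)\<^sup>2 \<partial>M) = \<sigma>\<^sup>2"
    using int[of "\<lambda>x. (x - \<mu>)\<^sup>2"] eq[of "\<lambda>x. (x - \<mu>)\<^sup>2"]
    by (simp_all add: power_mult_distrib std_normal_moments)
  show "(\<integral>\<omega>. iexp (X \<omega>) \<partial>M) = iexp \<mu> * of_real (exp (- \<sigma>\<^sup>2 / 2))"
    using eq[of iexp] char_std_normal_affine by simp
qed

text \<open>The projection of \<open>y\<close> on \<open>a\<close> is normal with mean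
  \<open>a \<bullet> m\<close> and variance \<open>a \<bullet> (S *v a)\<close>. Positivity is that
  of a variance, and the character comes from the one-dimensional formula. Projections on unit
  vectors supply the integrability needed to compute these parameters.\<close>

lemma
  fixes y :: "'a \<Rightarrow> real ^ 'n"
  assumes "multivariate_normal M y m S"
  shows multivariate_normal_covariance_sym: "S $ i $ j = S $ j $ i"
    and multivariate_normal_covariance_psd: "0 \<le> a \<bullet> (S *v a)"
    and multivariate_normal_iexp:
      "(\<integral>\<omega>. iexp (a \<bullet> y \<omega>) \<partial>M) = iexp (a \<bullet> m) * of_real (exp (- (a \<bullet> (S *v a)) / 2))"
proof -
  have y [measurable]: "y \<in> borel_measurable M"
    and gauss: "\<And>a. \<exists>\<mu> \<sigma>. 0 \<le> \<sigma> \<and> distr M borel (\<lambda>\<omega>. a \<bullet> y \<omega>) = normal_law \<mu> \<sigma>"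
    and m: "(\<integral>\<omega>. y \<omega> \<partial>M) = m" and S: "covariance_matrix M y = S"
    using assms by (auto simp: multivariate_normal_def gaussian_vector_def)
  have a_y: "(\<lambda>\<omega>. a \<bullet> y \<omega>) \<in> borel_measurable M" for a
    by measurable
  have y_i [measurable]: "(\<lambda>\<omega>. y \<omega> $ i) \<in> borel_measurable M" for i
    using a_y[of "axis i 1"] by (simp add: inner_axis')
  have int_i: "integrable M (\<lambda>\<omega>. y \<omega> $ i) \<and> integrable M (\<lambda>\<omega>. (y \<omega> $ i - (\<integral>\<omega>. y \<omega> $ i \<partial>M))\<^sup>2)" for i
  proof -
    obtain \<mu> \<sigma> where *: "0 \<le> \<sigma>" "distr M borel (\<lambda>\<omega>. axis i 1 \<bullet> y \<omega>) = normal_law \<mu> \<sigma>"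
      using gauss by blast
    then have "distr M borel (\<lambda>\<omega>. y \<omega> $ i) = normal_law \<mu> \<sigma>"
      by (simp add: inner_axis')
    note law = y_i *(1) this
    show ?thesis
      using normal_law_integrable[OF law] normal_law_square_integrable[OF law]
      unfolding normal_law_mean[OF law] by blast
  qed
  have int_y: "integrable M y"
  proof (rule Bochner_Integration.integrable_bound)
    show "integrable M (\<lambda>\<omega>. \<Sum>i\<in>UNIV. \<bar>y \<omega> $ i\<bar>)"
      using int_i by auto
    show "AE \<omega> in M. norm (y \<omega>) \<le> norm (\<Sum>i\<in>UNIV. \<bar>y \<omega> $ i\<bar>)"
      by (auto intro: order_trans[OF norm_le_l1_cart])
  qed simp
  have m_i: "(\<integral>\<omega>. y \<omega> $ i \<partial>M) = m $ i" for i
    using integral_bounded_linear[OF bounded_linear_vec_nth int_y] m by simp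
  have S_ij: "S $ i $ j = (\<integral>\<omega>. (y \<omega> $ i - m $ i) * (y \<omega> $ j - m $ j) \<partial>M)" for i j
    by (simp add: m_i flip: S covariance_matrix_def) (simp add: covariance_matrix_def m_i)
  then show "S $ i $ j = S $ j $ i" for i j
    by (simp add: mult.commute)
  \<comment> \<open>Mixed products are dominated by the sum of the two integrable squares.\<close>
  have int_ij: "integrable M (\<lambda>\<omega>. (y \<omega> $ i - m $ i) * (y \<omega> $ j - m $ j))" for i j
  proof (rule Bochner_Integration.integrable_bound)
    show "integrable M (\<lambda>\<omega>. (y \<omega> $ i - m $ i)\<^sup>2 + (y \<omega> $ j - m $ j)\<^sup>2)"
      using int_i by (simp add: m_i)
    have "\<bar>u * v\<bar> \<le> u\<^sup>2 + v\<^sup>2" for u v :: real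
    proof -
      have "2 * \<bar>u * v\<bar> \<le> u\<^sup>2 + v\<^sup>2"
        using sum_squares_bound[of "\<bar>u\<bar>" "\<bar>v\<bar>"] by (simp add: abs_mult mult.assoc)
      then show ?thesis
        using abs_ge_zero[of "u * v"] by linarith
    qed
    then show "AE \<omega> in M. norm ((y \<omega> $ i - m $ i) * (y \<omega> $ j - m $ j))
        \<le> norm ((y \<omega> $ i - m $ i)\<^sup>2 + (y \<omega> $ j - m $ j)\<^sup>2)"
      by simp
  qed simp
  obtain \<mu> \<sigma> where \<sigma>: "0 \<le> \<sigma>" "distr M borel (\<lambda>\<omega>. a \<bullet> y \<omega>) = normal_law \<mu> \<sigma>"
    using gauss by blast
  have \<mu>: "\<mu> = a \<bullet> m"
    using normal_law_mean[OF a_y \<sigma>] int_y m by simp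
  have "(a \<bullet> y \<omega> - a \<bullet> m)\<^sup>2 = (\<Sum>i\<in>UNIV. \<Sum>j\<in>UNIV. a $ i * a $ j * ((y \<omega> $ i - m $ i) * (y \<omega> $ j - m $ j)))" for \<omega>
  proof -
    have "(a \<bullet> y \<omega> - a \<bullet> m)\<^sup>2 = (\<Sum>i\<in>UNIV. a $ i * (y \<omega> $ i - m $ i))\<^sup>2"
      by (simp add: inner_vec_def right_diff_distrib sum_subtractf)
    then show ?thesis
      by (simp add: power2_eq_square sum_product mult_ac)
  qed
  then have "(\<integral>\<omega>. (a \<bullet> y \<omega> - a \<bullet> m)\<^sup>2 \<partial>M) = (\<Sum>i\<in>UNIV. \<Sum>j\<in>UNIV. a $ i * a $ j * S $ i $ j)"
    by (simp add: int_ij S_ij)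
  also have "\<dots> = a \<bullet> (S *v a)"
    by (simp add: inner_vec_def matrix_vector_mult_def sum_distrib_left mult_ac)
  finally have var: "\<sigma>\<^sup>2 = a \<bullet> (S *v a)"
    using normal_law_variance[OF a_y \<sigma>] by (simp add: \<mu>)
  then show "0 \<le> a \<bullet> (S *v a)" by (metis zero_le_power2)
  show "(\<integral>\<omega>. iexp (a \<bullet> y \<omega>) \<partial>M) = iexp (a \<bullet> m) * of_real (exp (- (a \<bullet> (S *v a)) / 2))"
    using normal_law_iexp[OF a_y \<sigma>] by (simp add: var \<mu>)
qed

text \<open>The character of the sum factors into functions of single coordinates, so the product
  measure turns its integral into a product of one-dimensional ones. The sum of squares is the
  quadratic form of the covariance matrix.\<close>

lemma iexp_std_normal_combination:
  fixes m :: "'b::euclidean_space" and c :: "nat \<Rightarrow> 'b"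
  shows "(\<integral>z. iexp (a \<bullet> (m + (\<Sum>i<d. z i *\<^sub>R c i))) \<partial>Pi\<^sub>M {..<d} (\<lambda>_. std_normal_distribution))
    = iexp (a \<bullet> m) * of_real (exp (- (\<Sum>i<d. (a \<bullet> c i)\<^sup>2) / 2))"
proof -
  interpret N: prob_space std_normal_distribution
    by (rule prob_space_normal_density) simp
  interpret product_sigma_finite "\<lambda>_::nat. std_normal_distribution"
    by standard (rule N.sigma_finite_countable)
  have "(\<integral>z. iexp (a \<bullet> (m + (\<Sum>i<d. z i *\<^sub>R c i))) \<partial>Pi\<^sub>M {..<d} (\<lambda>_. std_normal_distribution))
      = (\<integral>z. iexp (a \<bullet> m) * (\<Prod>i<d. iexp (0 + (a \<bullet> c i) * z i)) \<partial>Pi\<^sub>M {..<d} (\<lambda>_. std_normal_distribution))"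
  proof (rule Bochner_Integration.integral_cong[OF refl])
    fix z :: "nat \<Rightarrow> real"
    have "iexp (a \<bullet> (\<Sum>i<d. z i *\<^sub>R c i)) = (\<Prod>i<d. iexp (0 + (a \<bullet> c i) * z i))"
      by (induction d) (simp_all add: inner_add_right distrib_left exp_add mult_ac)
    then show "iexp (a \<bullet> (m + (\<Sum>i<d. z i *\<^sub>R c i))) = iexp (a \<bullet> m) * (\<Prod>i<d. iexp (0 + (a \<bullet> c i) * z i))"
      by (simp add: inner_add_right distrib_left exp_add)
  qed
  also have "\<dots> = iexp (a \<bullet> m) * (\<Prod>i<d. \<integral>x. iexp (0 + (a \<bullet> c i) * x) \<partial>std_normal_distribution)"
    by (subst integral_mult_right_zero, subst product_integral_prod)
      (auto intro!: N.integrable_const_bound[of _ 1])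
  also have "\<dots> = iexp (a \<bullet> m) * of_real (\<Prod>i<d. exp (- (a \<bullet> c i)\<^sup>2 / 2))"
    by (simp only: char_std_normal_affine) simp
  also have "(\<Prod>i<d. exp (- (a \<bullet> c i)\<^sup>2 / 2)) = exp (- (\<Sum>i<d. (a \<bullet> c i)\<^sup>2) / 2)"
    by (simp add: exp_sum[symmetric] sum_negf sum_divide_distrib)
  finally show ?thesis .
qed

section \<open>The chi-squared distribution and its quantiles\<close>

lemma prob_space_PiM_std_normal: "prob_space (Pi\<^sub>M I (\<lambda>_. std_normal_distribution))"
  by (intro prob_space_PiM prob_space_normal_density) simp

text \<open>Integrate over the last coordinate first: with the others fixed, a sphere has at most
  two points, a null set for the normal law. For \<open>d = 0\<close> the law is the point mass at
  0.\<close>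

lemma chi_squared_no_atoms:
  assumes "0 < d"
  shows "measure (chi_squared d) {x} = 0"
proof -
  interpret N: prob_space std_normal_distribution
    by (rule prob_space_normal_density) simp
  interpret product_sigma_finite "\<lambda>_::nat. std_normal_distribution"
    by standard (rule N.sigma_finite_countable)
  obtain n where d: "d = Suc n"
    using assms gr0_implies_Suc by blast
  let ?P = "Pi\<^sub>M {..<d} (\<lambda>_. std_normal_distribution)"
  let ?A = "{z \<in> space ?P. (\<Sum>i<d. (z i)\<^sup>2) = x}"
  have A: "?A \<in> sets ?P" by measurable
  have d_insert: "{..<d} = insert n {..<n}" by (simp add: d lessThan_Suc)
  have null: "(\<integral>\<^sup>+y. indicator {y. c + y\<^sup>2 = x} y \<partial>std_normal_distribution) = 0" for c
  proof -
    have "{y. c + y\<^sup>2 = x} \<subseteq> {sqrt (x - c), - sqrt (x - c)}"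
    proof
      fix y assume "y \<in> {y. c + y\<^sup>2 = x}"
      then have "\<bar>y\<bar> = sqrt (x - c)" by (auto simp flip: real_sqrt_abs)
      then show "y \<in> {sqrt (x - c), - sqrt (x - c)}" by (auto simp: abs_if split: if_splits)
    qed
    then have "finite {y. c + y\<^sup>2 = x}" by (rule finite_subset) simp
    then have N: "{y. c + y\<^sup>2 = x} \<in> null_sets lborel"
      by (rule finite_imp_null_set_lborel)
    then have "{y. c + y\<^sup>2 = x} \<in> sets lborel"
      by (rule null_setsD2)
    then have "(\<integral>\<^sup>+y. indicator {y. c + y\<^sup>2 = x} y \<partial>std_normal_distribution)
        = (\<integral>\<^sup>+y. ennreal (std_normal_density y) * indicator {y. c + y\<^sup>2 = x} y \<partial>lborel)"
      by (intro nn_integral_density) simp_all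
    also have "\<dots> = 0"
      by (rule nn_integral_null_set) (rule N)
    finally show ?thesis .
  qed
  have "emeasure ?P ?A = (\<integral>\<^sup>+z. indicator ?A z \<partial>?P)"
    using A by simp
  also have "\<dots> = (\<integral>\<^sup>+w. \<integral>\<^sup>+y. indicator ?A (w(n := y)) \<partial>std_normal_distribution
      \<partial>Pi\<^sub>M {..<n} (\<lambda>_. std_normal_distribution))"
    using A unfolding d_insert by (intro product_nn_integral_insert) auto
  also have "\<dots> = (\<integral>\<^sup>+w. 0 \<partial>Pi\<^sub>M {..<n} (\<lambda>_. std_normal_distribution))"
  proof (rule nn_integral_cong)
    fix w assume "w \<in> space (Pi\<^sub>M {..<n} (\<lambda>_::nat. std_normal_distribution))"
    then have "indicator ?A (w(n := y)) = (indicator {y. (\<Sum>i<n. (w i)\<^sup>2) + y\<^sup>2 = x} y :: ennreal)" for y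
      by (auto simp: d space_PiM PiE_def extensional_def split: split_indicator)
    then show "(\<integral>\<^sup>+y. indicator ?A (w(n := y)) \<partial>std_normal_distribution) = 0"
      by (simp add: null)
  qed
  finally have "emeasure ?P ?A = 0" by simp
  moreover have "measure (chi_squared d) {x} = measure ?P ?A"
    unfolding chi_squared_def by (subst measure_distr) (auto simp: vimage_def Int_def conj_commute)
  ultimately show ?thesis by (simp add: measure_def)
qed

text \<open>Without atoms \<open>Phi d\<close> is continuous; it starts at 0 and tends to 1, so the
  intermediate value theorem puts \<open>p\<close> in the image of \<open>{0..}\<close>. There
  \<open>inv_into\<close> is a genuine right inverse.\<close>

lemma
  assumes "0 < d" "0 \<le> p" "p < 1"
  shows Phi_Phi_inv: "Phi d (Phi_inv d p) = p"
    and Phi_inv_nonneg: "0 \<le> Phi_inv d p"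
proof -
  interpret P: prob_space "Pi\<^sub>M {..<d} (\<lambda>_. std_normal_distribution)"
    by (rule prob_space_PiM_std_normal)
  interpret C: real_distribution "chi_squared d"
    unfolding chi_squared_def by (rule P.real_distribution_distr) simp
  have cont: "isCont (Phi d) x" for x
    unfolding Phi_def C.isCont_cdf by (rule chi_squared_no_atoms) fact
  \<comment> \<open>A sum of squares is at most 0 only if it equals 0, and the point 0 carries no
    mass.\<close>
  have "{z. (\<Sum>i<d. (z i)\<^sup>2) \<le> 0} = {z. (\<Sum>i<d. (z i)\<^sup>2) = (0::real)}"
    using sum_nonneg[of "{..<d}" "\<lambda>i. (z i)\<^sup>2" for z :: "nat \<Rightarrow> real"] by (auto intro: antisym)
  then have "measure (chi_squared d) {..0} = measure (chi_squared d) {0}"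
    unfolding chi_squared_def by (simp add: measure_distr vimage_def)
  then have Phi0: "Phi d 0 = 0"
    unfolding Phi_def cdf_def using chi_squared_no_atoms[OF \<open>0 < d\<close>] by simp
  have "\<forall>\<^sub>F x in at_top. p < Phi d x"
    using C.cdf_lim_at_top_prob \<open>p < 1\<close> unfolding Phi_def by (rule order_tendstoD)
  then have "\<forall>\<^sub>F x in at_top. p < Phi d x \<and> 0 \<le> x"
    using eventually_ge_at_top by (rule eventually_conj)
  then obtain b where b: "p < Phi d b" "0 \<le> b"
    by (auto dest: eventually_happens)
  obtain x where "0 \<le> x" "Phi d x = p"
    using IVT[of "Phi d" 0 p b] Phi0 assms b cont by auto
  then have "p \<in> Phi d ` {0..}" by auto
  then show "Phi d (Phi_inv d p) = p" "0 \<le> Phi_inv d p"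
    unfolding Phi_inv_def using f_inv_into_f[of p "Phi d" "{0..}"] inv_into_into[of p "Phi d" "{0..}"]
    by auto
qed

section \<open>The Gaussian vector and the ball of prescribed probability\<close>

theorem theorem1:
  fixes M :: "'a measure" and y :: "'a \<Rightarrow> real ^ 'n"
    and y_bar :: "real ^ 'n" and Sigma_y :: "real ^ 'n ^ 'n" and \<beta> :: real
  assumes "prob_space M"
    and "multivariate_normal M y y_bar Sigma_y"
    and "0 < \<beta>" and "\<beta> < 1"
    and "\<And>i. y_bar $ i + Psi_inv CARD('n) \<beta> * rho Sigma_y \<le> 0"
  shows "\<P>(\<omega> in M. y \<omega> \<le> 0) \<ge> 1 - \<beta>"
proof -
  let ?d = "CARD('n)"
  let ?P = "Pi\<^sub>M {..<?d} (\<lambda>_::nat. std_normal_distribution)"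
  interpret M: prob_space M by fact
  interpret P: prob_space ?P by (rule prob_space_PiM_std_normal)
  have y [measurable]: "y \<in> borel_measurable M"
    using assms(2) by (simp add: multivariate_normal_def gaussian_vector_def)
  note sym = multivariate_normal_covariance_sym[OF assms(2)]
    and psd = multivariate_normal_covariance_psd[OF assms(2)]
  obtain A :: "'n \<Rightarrow> real ^ 'n" where A: "\<And>i j. Sigma_y $ i $ j = (\<Sum>k\<in>UNIV. A k $ i * A k $ j)"
    using psd_rank_one_decomposition[OF finite sym psd, of UNIV] by auto
  \<comment> \<open>The product measure is indexed by natural numbers, the factors \<open>A\<close>
    by the type of coordinates; an enumeration links the two.\<close>
  obtain h :: "nat \<Rightarrow> 'n" where h: "bij_betw h {..<?d} UNIV"
    using ex_bij_betw_nat_finite[of "UNIV :: 'n set"] by (auto simp: atLeast0LessThan)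
  define c where "c i = A (h i)" for i
  have cov: "Sigma_y $ i $ j = (\<Sum>k<?d. c k $ i * c k $ j)" for i j
    unfolding A c_def using sum.reindex_bij_betw[OF h, of "\<lambda>k. A k $ i * A k $ j"] by simp
  define X where "X z = y_bar + (\<Sum>i<?d. z i *\<^sub>R c i)" for z :: "nat \<Rightarrow> real"
  have X [measurable]: "X \<in> borel_measurable ?P"
    unfolding X_def by measurable
  have law: "distr M borel y = distr ?P borel X"
  proof (rule multivariate_char_uniqueness)
    show "prob_space (distr M borel y)" "prob_space (distr ?P borel X)"
      by (simp_all add: M.prob_space_distr P.prob_space_distr)
    fix a :: "real ^ 'n"
    \<comment> \<open>Matching the exponents of the two characteristic functions: expand the
      squares, then move the sum over \<open>k\<close> innermost to recover the entries of
      \<open>Sigma_y\<close>.\<close>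
    have "(\<Sum>k<?d. (a \<bullet> c k)\<^sup>2) = (\<Sum>k<?d. \<Sum>i\<in>UNIV. \<Sum>j\<in>UNIV. a $ i * (c k $ i * c k $ j) * a $ j)"
      by (simp add: inner_vec_def power2_eq_square sum_product mult_ac)
    also have "\<dots> = (\<Sum>i\<in>UNIV. \<Sum>k<?d. \<Sum>j\<in>UNIV. a $ i * (c k $ i * c k $ j) * a $ j)"
      by (rule sum.swap)
    also have "\<dots> = (\<Sum>i\<in>UNIV. \<Sum>j\<in>UNIV. \<Sum>k<?d. a $ i * (c k $ i * c k $ j) * a $ j)"
      by (intro sum.cong refl sum.swap)
    also have "\<dots> = a \<bullet> (Sigma_y *v a)"
      by (simp add: inner_vec_def matrix_vector_mult_def cov sum_distrib_left sum_distrib_right mult_ac)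
    finally have "(\<integral>z. iexp (a \<bullet> X z) \<partial>?P) = (\<integral>\<omega>. iexp (a \<bullet> y \<omega>) \<partial>M)"
      by (simp only: X_def iexp_std_normal_combination multivariate_normal_iexp[OF assms(2)])
    then show "(\<integral>x. iexp (a \<bullet> x) \<partial>distr M borel y) = (\<integral>x. iexp (a \<bullet> x) \<partial>distr ?P borel X)"
      by (simp add: integral_distr)
  qed simp_all
  \<comment> \<open>The squared radius of the ball in the space of \<open>z\<close>; its square root
    is \<open>Psi_inv ?d \<beta>\<close>.\<close>
  define r where "r = Phi_inv ?d (1 - \<beta>)"
  have "0 < ?d" by simp
  have r: "Phi ?d r = 1 - \<beta>" "0 \<le> r"
    unfolding r_def using Phi_Phi_inv[OF \<open>0 < ?d\<close>] Phi_inv_nonneg[OF \<open>0 < ?d\<close>] assms(3,4) by simp_all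
  have X_le: "X z \<le> 0" if z: "(\<Sum>i<?d. (z i)\<^sup>2) \<le> r" for z
    unfolding less_eq_vec_def
  proof
    fix i
    have "(\<Sum>k<?d. z k * c k $ i)\<^sup>2 \<le> (\<Sum>k<?d. (z k)\<^sup>2) * (\<Sum>k<?d. (c k $ i)\<^sup>2)"
      by (rule Cauchy_Schwarz_ineq_sum)
    also have "(\<Sum>k<?d. (c k $ i)\<^sup>2) = Sigma_y $ i $ i"
      by (simp add: cov power2_eq_square)
    \<comment> \<open>Monotonicity of the product needs nonnegative factors; the diagonal entry is a
      sum of squares.\<close>
    also have "(\<Sum>k<?d. (z k)\<^sup>2) * Sigma_y $ i $ i \<le> r * spectral_radius Sigma_y"
      using diagonal_le_spectral_radius[OF sym, of i] z \<open>0 \<le> r\<close>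
      by (intro mult_mono) (auto simp: cov intro!: sum_nonneg)
    finally have "(\<Sum>k<?d. z k * c k $ i) \<le> sqrt (r * spectral_radius Sigma_y)"
      by (rule real_le_rsqrt)
    also have "\<dots> = Psi_inv ?d \<beta> * rho Sigma_y"
      by (simp add: Psi_inv_def rho_def r_def real_sqrt_mult)
    finally show "X z $ i \<le> 0 $ i"
      using assms(5)[of i] by (simp add: X_def)
  qed
  have le_borel: "{x :: real ^ 'n. x \<le> 0} \<in> sets borel"
    using borel_closed[OF closed_eucl_atMost[of "0 :: real ^ 'n"]] by (simp add: atMost_def)
  have "1 - \<beta> = measure ?P {z \<in> space ?P. (\<Sum>i<?d. (z i)\<^sup>2) \<le> r}"
    unfolding r(1)[symmetric] Phi_def cdf_def chi_squared_def
    by (subst measure_distr) (auto simp: vimage_def Int_def conj_commute)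
  also have "\<dots> \<le> measure ?P {z \<in> space ?P. X z \<le> 0}"
    using X_le measurable_sets[OF X le_borel]
    by (intro P.finite_measure_mono) (auto simp: vimage_def Int_def conj_commute)
  also have "\<dots> = measure (distr ?P borel X) {x. x \<le> 0}"
    using le_borel by (subst measure_distr) (auto simp: vimage_def Int_def conj_commute)
  also have "\<dots> = measure (distr M borel y) {x. x \<le> 0}"
    by (simp add: law)
  also have "\<dots> = \<P>(\<omega> in M. y \<omega> \<le> 0)"
    using le_borel by (subst measure_distr) (auto simp: vimage_def Int_def conj_commute)
  finally show ?thesis .
qed

end
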